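(* Let $W$ be the Witten solution of the $n$-Gelfand--Dikii hierarchy and let $W^0$ be its part with $g=0$ (defined in the context). The functions $W$ and $W^0$ coincide on the set $L_0=\{(x_1,x_2,\dots,x_{n-1},0,0,\dots)\}$.
   Context: Here $n\ge 2$, functions of $x=(x_1,x_2,\dots)$ are understood as formal power series, $\partial_i=\partial/\partial x_i$ and $\partial=\partial_1$. KP hierarchy. For a function $v$ put $\eta_r=\sum_{l\ge1}\sum_{i_1+\cdots+i_l=r,\ i_j\ge1}\frac{(-1)^{l+1}}{l!\,i_1\cdots i_l}\partial_{i_1}\cdots\partial_{i_l}v$ ($r\ge1$), i.e. $\sum_{r\ge1}\eta_rk^{-r}=v(x)-v(x_1-k^{-1},x_2-\tfrac12k^{-2},\dots)$, and put $\psi(x,k)=\exp\bigl(\sum_{j\ge1}x_jk^j+\sum_{r\ge1}\eta_rk^{-r}\bigr)$. Then $v$ (which is $-\ln\tau$ for the tau-function $\tau$) is a solution of the KP hierarchy if for every $l\ge1$ one has $\partial_l\psi=L_l\psi$ for some operator $L_l=\partial^l+\sum_{i=2}^lB_l^i(x)\,\partial^{\,l-i}$. For KP solutions every $\partial_i\partial_jv$ is a universal polynomial, with rational coefficients, in the functions $\partial_s\partial^tv$ with $s,t\ge1$. Gelfand--Dikii hierarchy. Solutions of the $n$-Gelfand--Dikii hierarchy ($\partial_iL=[[L^{i/n}]_+,L]$, $i\ge1$, for $L=\partial^n+u_{n-2}\partial^{n-2}+\cdots+u_0$, where $[\cdot]_+$ is the differential part) correspond bijectively to the solutions of the KP hierarchy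 not depending on $x_n$. In terms of $v$, the hierarchy is equivalent to a system of differential equations $$\partial_{i_1}\cdots\partial_{i_k}v=\sum_{m\ge1}\sum N^m_{i_1\cdots i_k}\begin{pmatrix} s_1&\ldots&s_m\\ t_1&\ldots&t_m\end{pmatrix}\partial_{s_1}\partial^{t_1}v\cdots\partial_{s_m}\partial^{t_m}v\qquad(k\ge2,\ i_j\ge1),\qquad( * )$$ with the inner sum over integer matrices such that $1\le s_j<n$, $t_j\ge1$, $\sum_{j=1}^ki_j=\sum_{j=1}^m(s_j+t_j)$, $\sum_{j=1}^mt_j\ge m+k-2$ and $k+m+\sum_{j=1}^mt_j\equiv0\pmod2$. The $N^m_{i_1\cdots i_k}(\cdot)$ are universal rational constants (depending on $n$), computed recursively as follows: putting $\partial_m\partial_nv=0$ in the KP expressions for $\partial_m\partial_nv$ one expresses $\partial_r\partial v$ for $r>n$ through the $\partial_s\partial^tv$ with $s<n$; substituting this in the KP expressions for $\partial_i\partial_jv$ gives $( * )$ for $k=2$; and $( * )$ for $k>2$ is obtained from the case $k-1$ by applying $\partial_{i_k}$ and replacing the derivatives $\partial_s\partial_{i_k}v$ by means of the case $k=2$. Witten solution. $W$ is the single formal solution $v$ of the system $( * )$ satisfying the equation $$\partial v=\frac12\sum_{i+j=n}ij\,x_ix_j+\sum_{i=1}^\infty(i+n)x_{i+n}\,\partial_iv$$ and $0=v(0)=\partial_iv(0)$ for $i=1,2,\dots$. One has a decomposition $W=\sum_{g=0}^\infty W^g$, with $$W^g(x_1,x_2,\dots)=\sum_{k=2}^\infty\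 \sum_{i_1+\cdots+i_k=(n+1)(2g-2+k)}\frac{(n-1)^{2g-2+k}}{k!}\,N^{2g-2+k}_{i_1\cdots i_k}\begin{pmatrix} n-1&\ldots&n-1\\ 2&\ldots&2\end{pmatrix}x_{i_1}\cdots x_{i_k}$$ ($i_j\ge1$; the matrix has $2g-2+k$ columns); $W^0$ is the term with $g=0$. *)

theory Defs
  imports
    "HOL-Computational_Algebra.Formal_Laurent_Series"
    "HOL-Library.Poly_Mapping"
    Complex_Main
begin

section \<open>Formal power series in infinitely many variables\<close>

text \<open>
  The series in \<open>x\<^sub>1, x\<^sub>2, \<dots>\<close> are the functions from exponent vectors of finite support to
  coefficients. Position \<open>j\<close> of an exponent vector is the exponent of \<open>x\<^bsub>j+1\<^esub>\<close>, so that
  there is no spurious variable \<open>x\<^sub>0\<close>; \<open>xvar i\<close> and \<open>pd i\<close> below take the index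
  \<open>i \<ge> 1\<close> of the variable itself.
\<close>

type_synonym expo = "nat \<Rightarrow>\<^sub>0 nat"

typedef 'a mps = "UNIV :: (expo \<Rightarrow> 'a) set"
  morphisms mcoeff Mps ..

lemma mcoeff_Mps [simp]: "mcoeff (Mps f) = f"
  by (simp add: Mps_inverse)

lemma mps_eqI: "(\<And>a. mcoeff f a = mcoeff g a) \<Longrightarrow> f = g"
  by (metis ext mcoeff_inject)

definition splits :: "expo \<Rightarrow> (expo \<times> expo) set" where
  "splits a = {(b, c). b + c = a}"

lemma finite_splits [simp]: "finite (splits a)"
proof -
  define M where "M = Max (Poly_Mapping.lookup a ` Poly_Mapping.keys a)"
  define F where "F = {f :: nat \<Rightarrow> nat. \<forall>j. (j \<in> Poly_Mapping.keys a \<longrightarrow> f j \<in> {..M})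
      \<and> (j \<notin> Poly_Mapping.keys a \<longrightarrow> f j = 0)}"
  define B where "B = Poly_Mapping.lookup -` F"
  have "finite F" unfolding F_def by (rule finite_set_of_finite_funs) auto
  moreover have "inj (Poly_Mapping.lookup :: expo \<Rightarrow> nat \<Rightarrow> nat)"
    by (rule injI) (simp only: lookup_inject)
  ultimately have fin: "finite B" unfolding B_def by (rule finite_vimageI)
  have inB: "b \<in> B" if "b + c = a" for b c
  proof -
    have le: "Poly_Mapping.lookup b j \<le> Poly_Mapping.lookup a j" for j
      unfolding that[symmetric] lookup_add by simp
    have "Poly_Mapping.lookup a j \<le> M" if "j \<in> Poly_Mapping.keys a" for j
      unfolding M_def using that by (intro Max_ge) auto
    moreover have "Poly_Mapping.lookup b j = 0" if "j \<notin> Poly_Mapping.keys a" for j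
      using le[of j] that by (simp add: in_keys_iff)
    ultimately show ?thesis
      unfolding B_def F_def using le by (auto intro: le_trans)
  qed
  have "splits a \<subseteq> B \<times> B"
  proof
    fix p assume "p \<in> splits a"
    then obtain b c where p: "p = (b, c)" "b + c = a" by (auto simp: splits_def)
    then have "c + b = a" by (simp only: add.commute)
    with p show "p \<in> B \<times> B" using inB by blast
  qed
  moreover have "finite (B \<times> B)" using fin by blast
  ultimately show ?thesis by (rule finite_subset)
qed

instantiation mps :: (comm_ring_1) comm_ring_1
begin

definition "0 = Mps (\<lambda>a. 0)"
definition "1 = Mps (\<lambda>a. if a = 0 then 1 else 0)"
definition "f + g = Mps (\<lambda>a. mcoeff f a + mcoeff g a)"
definition "- f = Mps (\<lambda>a. - mcoeff f a)"
definition "f - g = Mps (\<lambda>a. mcoeff f a - mcoeff g a)"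
definition "f * g = Mps (\<lambda>a. \<Sum>(b, c)\<in>splits a. mcoeff f b * mcoeff g c)"

instance
proof
  fix f g h :: "'a mps"
  note d = zero_mps_def one_mps_def plus_mps_def uminus_mps_def minus_mps_def times_mps_def
  show "f + g + h = f + (g + h)" "f + g = g + f" "0 + f = f" "- f + f = 0" "f - g = f + - g"
    by (auto simp: d mcoeff_inverse intro!: mps_eqI)
  show "(f + g) * h = f * h + g * h"
    by (auto simp: d split_def distrib_right sum.distrib intro!: mps_eqI)
  show "f * g = g * f"
  proof (rule mps_eqI)
    fix a
    have "(\<Sum>(b, c)\<in>splits a. mcoeff f b * mcoeff g c) = (\<Sum>(b, c)\<in>splits a. mcoeff g b * mcoeff f c)"
      by (rule sum.reindex_bij_witness[where i = prod.swap and j = prod.swap])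
         (auto simp: splits_def add.commute mult.commute)
    then show "mcoeff (f * g) a = mcoeff (g * f) a" by (simp add: d)
  qed
  show "1 * f = f"
  proof (rule mps_eqI)
    fix a
    have "(\<Sum>(b, c)\<in>splits a. (if b = 0 then 1 else 0) * mcoeff f c)
        = (\<Sum>(b, c)\<in>{(0::expo, a)}. (if b = 0 then 1 else 0) * mcoeff f c)"
      by (rule sum.mono_neutral_right[OF finite_splits]) (auto simp: splits_def split: if_splits)
    then show "mcoeff (1 * f) a = mcoeff f a" by (simp add: d)
  qed
  show "f * g * h = f * (g * h)"
  proof (rule mps_eqI)
    fix a
    have "mcoeff (f * g * h) a =
      (\<Sum>p\<in>splits a. \<Sum>q\<in>splits (fst p). mcoeff f (fst q) * mcoeff g (snd q) * mcoeff h (snd p))"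
      by (simp add: d split_def sum_distrib_right)
    also have "\<dots> = (\<Sum>(p, q)\<in>(SIGMA p:splits a. splits (fst p)).
        mcoeff f (fst q) * mcoeff g (snd q) * mcoeff h (snd p))"
      by (rule sum.Sigma) auto
    also have "\<dots> = (\<Sum>(p, q)\<in>(SIGMA p:splits a. splits (snd p)).
        mcoeff f (fst p) * (mcoeff g (fst q) * mcoeff h (snd q)))"
      by (rule sum.reindex_bij_witness[where
            i = "\<lambda>(p, q). ((fst p + fst q, snd q), (fst p, fst q))" and
            j = "\<lambda>(p, q). ((fst q, snd q + snd p), (snd q, snd p))"])
         (auto simp: splits_def add.assoc mult.assoc)
    also have "\<dots> = (\<Sum>p\<in>splits a. \<Sum>q\<in>splits (snd p).
        mcoeff f (fst p) * (mcoeff g (fst q) * mcoeff h (snd q)))"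
      by (rule sum.Sigma[symmetric]) auto
    also have "\<dots> = mcoeff (f * (g * h)) a"
      by (simp add: d split_def sum_distrib_left)
    finally show "mcoeff (f * g * h) a = mcoeff (f * (g * h)) a" .
  qed
  have "mcoeff (0 :: 'a mps) 0 \<noteq> mcoeff 1 0" by (simp add: d)
  then show "(0 :: 'a mps) \<noteq> 1" by (rule contrapos_nn) (rule arg_cong)
qed

end

definition mconst :: "'a::zero \<Rightarrow> 'a mps" where
  "mconst c = Mps (\<lambda>a. if a = 0 then c else 0)"

definition xvar :: "nat \<Rightarrow> 'a::zero_neq_one mps" where
  "xvar i = Mps (\<lambda>a. if a = Poly_Mapping.single (i - 1) 1 then 1 else 0)"

definition pd :: "nat \<Rightarrow> 'a::comm_ring_1 mps \<Rightarrow> 'a mps" where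
  "pd i f = Mps (\<lambda>a. of_nat (Poly_Mapping.lookup a (i - 1) + 1)
                      * mcoeff f (a + Poly_Mapping.single (i - 1) 1))"

text \<open>The sum of a (possibly infinite) family in which every exponent vector occurs only finitely often.\<close>

definition mps_sum :: "'i set \<Rightarrow> ('i \<Rightarrow> 'a::comm_ring_1 mps) \<Rightarrow> 'a mps" where
  "mps_sum I f = Mps (\<lambda>a. \<Sum>i | i \<in> I \<and> mcoeff (f i) a \<noteq> 0. mcoeff (f i) a)"


section \<open>The KP hierarchy\<close>

definition eta :: "nat \<Rightarrow> complex mps \<Rightarrow> complex mps" where
  "eta r v = (\<Sum>is | (\<forall>i\<in>set is. 1 \<le> i) \<and> sum_list is = r \<and> is \<noteq> [].
      mconst ((-1) ^ (length is + 1) / (fact (length is) * of_nat (prod_list is))) * foldr pd is v)"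

text \<open>
  Functions of \<open>(x, k)\<close> are power series in \<open>x\<close> whose coefficients are formal Laurent series
  in \<^const>\<open>fls_X\<close>, which stands for \<open>1/k\<close>; thus \<^const>\<open>fls_X_inv\<close> stands for \<open>k\<close>.

  The sign \<open>\<epsilon>\<close> is the normalisation \<open>v = -\<epsilon> ln \<tau>\<close> of \<open>v\<close>: the exponent is
  \<open>\<Sum>\<^sub>j x\<^sub>j k\<^sup>j + \<epsilon> \<Sum>\<^sub>r \<eta>\<^sub>r / k\<^sup>r\<close>. The choice \<open>\<epsilon> = 1\<close> gives \<open>v = -ln \<tau>\<close>. The choice
  \<open>\<epsilon> = -1\<close>, i.e. \<open>v = ln \<tau>\<close>, is the one for which the equation
  \<open>witten_string\<close> below is compatible with the hierarchy: for \<open>n = 2\<close> that equation gives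
  \<open>\<partial>\<^sub>1\<partial>\<^sub>3v = 3/2 x\<^sub>1\<^sup>2 = 3/2 (\<partial>\<^sup>2v)\<^sup>2\<close> on the \<open>x\<^sub>1\<close>-axis, while the hierarchy gives
  \<open>\<partial>\<^sub>1\<partial>\<^sub>3v = 1/4 \<partial>\<^sup>4v - \<epsilon> 3/2 (\<partial>\<^sup>2v)\<^sup>2\<close>.
\<close>

definition kp_exponent :: "complex \<Rightarrow> complex mps \<Rightarrow> complex fls mps" where
  "kp_exponent \<epsilon> v =
     mps_sum {1..} (\<lambda>j. mconst (fls_X_inv ^ j) * xvar j)
     + Mps (\<lambda>a. fps_to_fls (Abs_fps (\<lambda>r. if r = 0 then 0 else \<epsilon> * mcoeff (eta r v) a)))"

text \<open>
  The exponential series, summed separately at every monomial \<open>x\<^sup>a k\<^bsup>-d\<^esup>\<close>. For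
  \<open>f = kp_exponent \<epsilon> v\<close> only finitely many powers of \<open>f\<close> contain a given monomial, because the
  terms of \<open>f\<close> that are free of \<open>x\<close> involve negative powers of \<open>k\<close> only.
\<close>

definition mexp :: "complex fls mps \<Rightarrow> complex fls mps" where
  "mexp f = Mps (\<lambda>a. Abs_fls (\<lambda>d.
     \<Sum>m | fls_nth (mcoeff (f ^ m) a) d \<noteq> 0. fls_nth (mcoeff (f ^ m) a) d / fact m))"

definition kp_psi :: "complex \<Rightarrow> complex mps \<Rightarrow> complex fls mps" where
  "kp_psi \<epsilon> v = mexp (kp_exponent \<epsilon> v)"

definition const_in_k :: "complex mps \<Rightarrow> complex fls mps" where
  "const_in_k f = Mps (\<lambda>a. fls_const (mcoeff f a))"

definition kp_solution :: "complex \<Rightarrow> complex mps \<Rightarrow> bool" where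
  "kp_solution \<epsilon> v \<longleftrightarrow> (\<forall>l\<ge>1. \<exists>B :: nat \<Rightarrow> complex mps.
     pd l (kp_psi \<epsilon> v) = (pd 1 ^^ l) (kp_psi \<epsilon> v)
       + (\<Sum>i=2..l. const_in_k (B i) * (pd 1 ^^ (l - i)) (kp_psi \<epsilon> v)))"


section \<open>Polynomials in the derivatives of v\<close>

text \<open>The variable \<open>(s, t)\<close> stands for \<open>\<partial>\<^sub>s\<partial>\<^sup>tv\<close>, where \<open>s, t \<ge> 1\<close>.\<close>

type_synonym jpoly = "((nat \<times> nat) \<Rightarrow>\<^sub>0 nat) \<Rightarrow>\<^sub>0 rat"

definition jconst :: "rat \<Rightarrow> jpoly" where
  "jconst c = Poly_Mapping.single 0 c"

definition jvar :: "nat \<times> nat \<Rightarrow> jpoly" where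
  "jvar z = Poly_Mapping.single (Poly_Mapping.single z 1) 1"

definition jvars :: "jpoly \<Rightarrow> (nat \<times> nat) set" where
  "jvars p = (\<Union>m\<in>Poly_Mapping.keys p. Poly_Mapping.keys m)"

text \<open>Substitution of \<open>f z\<close> for the variables \<open>z\<close>, with \<open>c\<close> embedding the coefficients:\<close>

definition jsubst :: "(rat \<Rightarrow> 'b) \<Rightarrow> (nat \<times> nat \<Rightarrow> 'b) \<Rightarrow> jpoly \<Rightarrow> 'b::comm_ring_1" where
  "jsubst c f p = (\<Sum>m\<in>Poly_Mapping.keys p.
     c (Poly_Mapping.lookup p m) * (\<Prod>z\<in>Poly_Mapping.keys m. f z ^ Poly_Mapping.lookup m z))"

text \<open>The derivation of the polynomial ring with prescribed values \<open>d z\<close> on the variables \<open>z\<close>:\<close>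

definition jderivation :: "(nat \<times> nat \<Rightarrow> jpoly) \<Rightarrow> jpoly \<Rightarrow> jpoly" where
  "jderivation d p = (\<Sum>m\<in>Poly_Mapping.keys p. \<Sum>z\<in>Poly_Mapping.keys m.
     Poly_Mapping.single (m - Poly_Mapping.single z 1)
       (Poly_Mapping.lookup p m * of_nat (Poly_Mapping.lookup m z)) * d z)"

text \<open>The operator \<open>\<partial>\<close>:\<close>

definition jD :: "jpoly \<Rightarrow> jpoly" where
  "jD = jderivation (\<lambda>(s, t). jvar (s, t + 1))"

text \<open>Here \<open>(pd 1 ^^ t) v\<close> is \<open>\<partial>\<^sup>tv\<close>.\<close>

definition jet :: "complex mps \<Rightarrow> nat \<times> nat \<Rightarrow> complex mps" where
  "jet v = (\<lambda>(s, t). pd s ((pd 1 ^^ t) v))"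

text \<open>
  The universal polynomial expressing \<open>\<partial>\<^sub>i\<partial>\<^sub>jv\<close> for KP solutions. It is unique because the values of
  finitely many \<open>\<partial>\<^sub>s\<partial>\<^sup>tv(0)\<close> (\<open>s, t \<ge> 1\<close>) can be prescribed arbitrarily for KP solutions.
\<close>

definition kp_poly :: "complex \<Rightarrow> nat \<Rightarrow> nat \<Rightarrow> jpoly" where
  "kp_poly \<epsilon> i j = (THE p. jvars p \<subseteq> {1..} \<times> {1..} \<and>
     (\<forall>v. kp_solution \<epsilon> v \<longrightarrow> pd i (pd j v) = jsubst (\<lambda>c. mconst (of_rat c)) (jet v) p))"


section \<open>The Gelfand--Dikii hierarchy\<close>

text \<open>
  For \<open>r \<ge> n\<close>, \<open>gd_elim \<epsilon> n r\<close> expresses \<open>\<partial>\<^sub>r\<partial>v\<close> through the \<open>\<partial>\<^sub>s\<partial>\<^sup>tv\<close> with \<open>s < n\<close>: it is obtained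
  from \<open>\<partial>\<^sub>m\<partial>\<^sub>nv = 0\<close>, \<open>m = r + 1 - n\<close>, by solving for \<open>\<partial>\<^sub>r\<partial>v\<close>. The KP expression of \<open>\<partial>\<^sub>m\<partial>\<^sub>nv\<close> is
  homogeneous of weight \<open>m + n = r + 1\<close> if \<open>\<partial>\<^sub>s\<partial>\<^sup>tv\<close> has weight \<open>s + t\<close>, so it is a nonzero multiple
  of \<open>\<partial>\<^sub>r\<partial>v\<close> plus a polynomial in the \<open>\<partial>\<^sub>s\<partial>\<^sup>tv\<close> with \<open>s < r\<close>; the branch \<open>0\<close> is not reached.
\<close>

fun gd_elim :: "complex \<Rightarrow> nat \<Rightarrow> nat \<Rightarrow> jpoly" where
  "gd_elim \<epsilon> n r =
     (let p = kp_poly \<epsilon> (r + 1 - n) n;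
          c = Poly_Mapping.lookup p (Poly_Mapping.single (r, 1) 1)
      in jconst (- 1 / c) * jsubst jconst
           (\<lambda>(s, t). if s < n then jvar (s, t)
                      else if s < r then (jD ^^ (t - 1)) (gd_elim \<epsilon> n s)
                      else 0)
           (p - jconst c * jvar (r, 1)))"

declare gd_elim.simps [simp del]

definition gd_poly2 :: "complex \<Rightarrow> nat \<Rightarrow> nat \<Rightarrow> nat \<Rightarrow> jpoly" where
  "gd_poly2 \<epsilon> n i j = jsubst jconst
     (\<lambda>(s, t). if s < n then jvar (s, t) else (jD ^^ (t - 1)) (gd_elim \<epsilon> n s))
     (kp_poly \<epsilon> i j)"

text \<open>The operator \<open>\<partial>\<^sub>i\<close>, with \<open>\<partial>\<^sub>i\<partial>\<^sub>s\<partial>\<^sup>tv = \<partial>\<^sup>t(\<partial>\<^sub>s\<partial>\<^sub>iv)\<close> rewritten by means of \<open>gd_poly2\<close>:\<close>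

definition gd_deriv :: "complex \<Rightarrow> nat \<Rightarrow> nat \<Rightarrow> jpoly \<Rightarrow> jpoly" where
  "gd_deriv \<epsilon> n i = jderivation (\<lambda>(s, t). (jD ^^ t) (gd_poly2 \<epsilon> n s i))"

text \<open>The expression for \<open>\<partial>\<^bsub>i\<^sub>1\<^esub> \<dots> \<partial>\<^bsub>i\<^sub>k\<^esub> v\<close>, obtained from \<open>\<partial>\<^bsub>i\<^sub>1\<^esub>\<partial>\<^bsub>i\<^sub>2\<^esub> v\<close> by applying \<open>\<partial>\<^bsub>i\<^sub>3\<^esub>\<close>, \<dots>,
  \<open>\<partial>\<^bsub>i\<^sub>k\<^esub>\<close> in this order; irrelevant for \<open>k < 2\<close>.\<close>

fun gd_poly :: "complex \<Rightarrow> nat \<Rightarrow> nat list \<Rightarrow> jpoly" where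
  "gd_poly \<epsilon> n (i # j # is) = foldl (\<lambda>p i'. gd_deriv \<epsilon> n i' p) (gd_poly2 \<epsilon> n i j) is"
| "gd_poly \<epsilon> n _ = 0"

text \<open>
  The constants \<open>N\<close>. A matrix is the list of its columns \<open>(s\<^sub>j, t\<^sub>j)\<close>. As matrices that differ by the
  order of their columns give the same product of derivatives, the coefficient of that product is
  divided evenly among them; for a matrix all of whose columns are equal, \<open>N\<close> is the coefficient.
\<close>

definition gd_N :: "complex \<Rightarrow> nat \<Rightarrow> nat list \<Rightarrow> (nat \<times> nat) list \<Rightarrow> rat" where
  "gd_N \<epsilon> n is cs =
     Poly_Mapping.lookup (gd_poly \<epsilon> n is) (\<Sum>z\<leftarrow>cs. Poly_Mapping.single z 1)
       / of_nat (card {ds. mset ds = mset cs})"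

text \<open>The matrices over which the inner sum of the hierarchy extends (all \<open>m \<ge> 1\<close> together):\<close>

definition gd_matrices :: "nat \<Rightarrow> nat list \<Rightarrow> (nat \<times> nat) list set" where
  "gd_matrices n is = {cs. length cs \<ge> 1
     \<and> (\<forall>(s, t)\<in>set cs. 1 \<le> s \<and> s < n \<and> 1 \<le> t)
     \<and> sum_list is = (\<Sum>(s, t)\<leftarrow>cs. s + t)
     \<and> int (\<Sum>(s, t)\<leftarrow>cs. t) \<ge> int (length cs) + int (length is) - 2
     \<and> even (length is + length cs + (\<Sum>(s, t)\<leftarrow>cs. t))}"

definition gd_system :: "complex \<Rightarrow> nat \<Rightarrow> complex mps \<Rightarrow> bool" where
  "gd_system \<epsilon> n v \<longleftrightarrow> (\<forall>is. length is \<ge> 2 \<and> (\<forall>i\<in>set is. 1 \<le> i) \<longrightarrow>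
     foldr pd is v = (\<Sum>cs\<in>gd_matrices n is.
        mconst (of_rat (gd_N \<epsilon> n is cs)) * (\<Prod>z\<leftarrow>cs. jet v z)))"


section \<open>The Witten solution\<close>

definition witten_string :: "nat \<Rightarrow> complex mps \<Rightarrow> bool" where
  "witten_string n v \<longleftrightarrow>
     pd 1 v = mconst (1/2) * (\<Sum>(i, j) | 1 \<le> i \<and> 1 \<le> j \<and> i + j = n. of_nat (i * j) * (xvar i * xvar j))
       + mps_sum {1..} (\<lambda>i. of_nat (i + n) * xvar (i + n) * pd i v)"

definition witten_solution :: "complex \<Rightarrow> nat \<Rightarrow> complex mps \<Rightarrow> bool" where
  "witten_solution \<epsilon> n v \<longleftrightarrow> gd_system \<epsilon> n v \<and> witten_string n v
     \<and> mcoeff v 0 = 0 \<and> (\<forall>i\<ge>1. mcoeff (pd i v) 0 = 0)"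

text \<open>The part \<open>W\<^sup>g\<close>; the summation index is the list \<open>i\<^sub>1, \<dots>, i\<^sub>k\<close>.\<close>

definition witten_part :: "complex \<Rightarrow> nat \<Rightarrow> nat \<Rightarrow> complex mps" where
  "witten_part \<epsilon> n g =
     mps_sum {is. length is \<ge> 2 \<and> (\<forall>i\<in>set is. 1 \<le> i)
                   \<and> sum_list is = (n + 1) * (2 * g + length is - 2)}
       (\<lambda>is. let m = 2 * g + length is - 2 in
          mconst (of_nat (n - 1) ^ m / fact (length is)
                  * of_rat (gd_N \<epsilon> n is (replicate m (n - 1, 2))))
          * (\<Prod>i\<leftarrow>is. xvar i))"

text \<open>The restriction of \<open>f\<close> to \<open>L\<^sub>0 = {(x\<^sub>1, \<dots>, x\<^bsub>n-1\<^esub>, 0, 0, \<dots>)}\<close>: the monomials that contain some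
  \<open>x\<^sub>i\<close> with \<open>i \<ge> n\<close> are set to \<open>0\<close>.\<close>

definition restrict_L0 :: "nat \<Rightarrow> 'a::zero mps \<Rightarrow> 'a mps" where
  "restrict_L0 n f =
     Mps (\<lambda>a. if \<forall>i\<ge>n. Poly_Mapping.lookup a (i - 1) = 0 then mcoeff f a else 0)"

end

theory Submission
  imports Defs "HOL-Combinatorics.Multiset_Permutations"
begin

text \<open>
  The coefficients of \<open>W\<close> are its iterated derivatives at \<open>0\<close>, which the system expresses through
  the values \<open>\<partial>\<^sub>s\<partial>\<^sup>tW(0)\<close> with \<open>s < n\<close>. Where \<open>x\<^sub>i = 0\<close> for all \<open>i > n\<close>, the string equation reads
  \<open>\<partial>W = 1/2 \<Sum> i j x\<^sub>i x\<^sub>j\<close> (sum over \<open>i + j = n\<close>), so that only \<open>\<partial>\<^bsub>n-1\<^esub>\<partial>\<^sup>2W(0) = n - 1\<close> is nonzero. Hence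
  \<open>\<partial>\<^bsub>i\<^sub>1\<^esub>\<dots>\<partial>\<^bsub>i\<^sub>k\<^esub>W(0)\<close> is \<open>(n-1)\<^sup>m N\<close> for the matrix with \<open>m\<close> columns \<open>(n-1, 2)\<close>, where
  \<open>m = 2g - 2 + k\<close> with \<open>g \<ge> 0\<close> and \<open>i\<^sub>1 + \<dots> + i\<^sub>k = (n+1) m\<close>. If all \<open>i\<^sub>j < n\<close>, this sum is at most
  \<open>(n-1) k\<close>, which forces \<open>g = 0\<close>.
\<close>

section \<open>Coefficients of formal power series\<close>

lemma mcoeff_0 [simp]: "mcoeff 0 a = 0"
  by (simp add: zero_mps_def)

lemma mcoeff_1: "mcoeff 1 a = (if a = 0 then 1 else 0)"
  by (simp add: one_mps_def)

lemma mcoeff_add [simp]: "mcoeff (f + g) a = mcoeff f a + mcoeff g a"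
  by (simp add: plus_mps_def)

lemma mcoeff_mult: "mcoeff (f * g) a = (\<Sum>(b, c)\<in>splits a. mcoeff f b * mcoeff g c)"
  by (simp add: times_mps_def)

lemma mcoeff_sum: "mcoeff (sum f A) a = (\<Sum>i\<in>A. mcoeff (f i) a)"
  by (induction A rule: infinite_finite_induct) auto

lemma mcoeff_pd: "mcoeff (pd i f) a = of_nat (Poly_Mapping.lookup a (i - 1) + 1)
    * mcoeff f (a + Poly_Mapping.single (i - 1) 1)"
  by (simp add: pd_def)

lemma mcoeff_mconst_mult [simp]: "mcoeff (mconst c * f) a = c * mcoeff f a"
proof -
  have "mcoeff (mconst c * f) a
      = (\<Sum>(b, d)\<in>{(0 :: expo, a)}. mcoeff (mconst c) b * mcoeff f d)"
    unfolding mcoeff_mult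
    by (rule sum.mono_neutral_right[OF finite_splits])
       (auto simp: splits_def mconst_def split: if_splits)
  then show ?thesis by (simp add: mconst_def)
qed

lemma mcoeff_of_nat_mult [simp]: "mcoeff (of_nat k * f) a = of_nat k * mcoeff f a"
  by (induction k) (simp_all add: distrib_right)

lemma expo_add_eq_0_iff: "b + c = (0 :: expo) \<longleftrightarrow> b = 0 \<and> c = 0"
  by (auto simp: poly_mapping_eq_iff fun_eq_iff lookup_add)

lemma splits_0: "splits 0 = {(0, 0)}"
  by (auto simp: splits_def expo_add_eq_0_iff)

lemma mcoeff_mult_0: "mcoeff (f * g) 0 = mcoeff f 0 * mcoeff g 0"
  by (simp add: mcoeff_mult splits_0)

lemma mcoeff_prod_list_0: "mcoeff (\<Prod>z\<leftarrow>zs. f z) 0 = (\<Prod>z\<leftarrow>zs. mcoeff (f z) 0)"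
  by (induction zs) (simp_all add: mcoeff_1 mcoeff_mult_0)

lemma mcoeff_xvar_mult_eq_0:
  assumes "Poly_Mapping.lookup a (i - 1) = 0"
  shows "mcoeff (xvar i * f) a = 0"
  unfolding mcoeff_mult
  using assms by (intro sum.neutral) (auto simp: splits_def xvar_def lookup_add)

lemma mcoeff_xvar_mult_single:
  "mcoeff (xvar i * f) (Poly_Mapping.single (i - 1) 1 + a) = mcoeff f a"
proof -
  have "mcoeff (xvar i * f) (Poly_Mapping.single (i - 1) 1 + a)
      = (\<Sum>(b, d)\<in>{(Poly_Mapping.single (i - 1) 1 :: expo, a)}. mcoeff (xvar i) b * mcoeff f d)"
    unfolding mcoeff_mult
    by (rule sum.mono_neutral_right[OF finite_splits])
       (auto simp: splits_def xvar_def split: if_splits)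
  then show ?thesis by (simp add: xvar_def)
qed


section \<open>Monomials as lists of indices\<close>

text \<open>The exponent vector of x_{i_1}...x_{i_k}. Truncated subtraction would identify the
  indices 0 and 1, so the lemmas below that count occurrences assume all indices positive.\<close>

definition list_expo :: "nat list \<Rightarrow> expo" where
  "list_expo is = (\<Sum>i\<leftarrow>is. Poly_Mapping.single (i - 1) 1)"

lemma list_expo_Nil [simp]: "list_expo [] = 0"
  and list_expo_Cons: "list_expo (i # is) = Poly_Mapping.single (i - 1) 1 + list_expo is"
  by (simp_all add: list_expo_def)

lemma lookup_list_expo:
  assumes "\<forall>i\<in>set is. 1 \<le> i"
  shows "Poly_Mapping.lookup (list_expo is) j = count (mset is) (Suc j)"
  using assms
proof (induction "is")
  case (Cons i "is")
  have "i - 1 = j \<longleftrightarrow> i = Suc j" using Cons.prems by auto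
  then show ?case using Cons
    by (simp add: list_expo_Cons lookup_add lookup_single when_def)
qed simp

lemma list_expo_eq_iff:
  assumes "\<forall>i\<in>set is. 1 \<le> i" "\<forall>j\<in>set js. 1 \<le> j"
  shows "list_expo is = list_expo js \<longleftrightarrow> mset is = mset js"
proof
  assume eq: "list_expo is = list_expo js"
  show "mset is = mset js"
  proof (rule multiset_eqI)
    fix i
    show "count (mset is) i = count (mset js) i"
    proof (cases i)
      case 0
      then have "i \<notin> set is" "i \<notin> set js" using assms by auto
      then show ?thesis by (metis count_mset_0_iff)
    next
      case (Suc j)
      then show ?thesis
        using eq lookup_list_expo[OF assms(1), of j] lookup_list_expo[OF assms(2), of j] by simp
    qed
  qed
next
  assume "mset is = mset js"
  then show "list_expo is = list_expo js"
    unfolding list_expo_def by (simp flip: sum_mset_sum_list)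
qed

lemma list_expo_surj: obtains "is" where "\<forall>i\<in>set is. 1 \<le> i" "list_expo is = a"
proof -
  define A where "A = (\<Sum>j\<in>Poly_Mapping.keys a. replicate_mset (Poly_Mapping.lookup a j) (Suc j))"
  obtain "is" where A: "A = mset is" by (metis ex_mset)
  have "\<forall>i\<in>#A. 1 \<le> i" by (auto simp: A_def set_mset_sum split: if_splits)
  then have pos: "\<forall>i\<in>set is. 1 \<le> i" by (simp add: A)
  have "count A (Suc j) = Poly_Mapping.lookup a j" for j
    by (simp add: A_def count_sum in_keys_iff)
  then have "list_expo is = a"
    by (intro poly_mapping_eqI) (simp add: lookup_list_expo[OF pos] A)
  with pos show thesis by (rule that)
qed

lemma mcoeff_prod_list_xvar:
  "mcoeff (\<Prod>i\<leftarrow>is. xvar i) a = (if a = list_expo is then 1 else 0)"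
proof (induction "is" arbitrary: a)
  case (Cons i "is")
  show ?case
  proof (cases "Poly_Mapping.lookup a (i - 1) = 0")
    case True
    then have "a \<noteq> list_expo (i # is)" by (auto simp: list_expo_Cons lookup_add)
    with True show ?thesis by (simp add: mcoeff_xvar_mult_eq_0)
  next
    case False
    then have "a = Poly_Mapping.single (i - 1) 1 + (a - Poly_Mapping.single (i - 1) 1)"
      by (intro poly_mapping_eqI) (auto simp: lookup_add lookup_minus lookup_single when_def)
    then obtain b where a: "a = Poly_Mapping.single (i - 1) 1 + b" by blast
    show ?thesis
      unfolding a list_expo_Cons list.map prod_list.Cons mcoeff_xvar_mult_single Cons.IH by simp
  qed
qed (simp add: mcoeff_1)


section \<open>Taylor coefficients\<close>

text \<open>The multi-index factorial a! of Taylor's formula.\<close>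

definition expo_fact :: "expo \<Rightarrow> nat" where
  "expo_fact a = (\<Prod>j\<in>Poly_Mapping.keys a. fact (Poly_Mapping.lookup a j))"

lemma expo_fact_superset:
  assumes "finite K" "Poly_Mapping.keys a \<subseteq> K"
  shows "expo_fact a = (\<Prod>j\<in>K. fact (Poly_Mapping.lookup a j))"
  unfolding expo_fact_def using assms
  by (intro prod.mono_neutral_left) (auto simp: in_keys_iff)

lemma expo_fact_0 [simp]: "expo_fact 0 = 1"
  by (simp add: expo_fact_def)

lemma expo_fact_add_single:
  "expo_fact (a + Poly_Mapping.single i 1) = (Poly_Mapping.lookup a i + 1) * expo_fact a"
proof -
  let ?K = "insert i (Poly_Mapping.keys a)" and ?b = "a + Poly_Mapping.single i 1"
  have "expo_fact ?b = (\<Prod>j\<in>?K. fact (Poly_Mapping.lookup ?b j))"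
    using Poly_Mapping.keys_add[of a "Poly_Mapping.single i 1"]
    by (intro expo_fact_superset) auto
  also have "\<dots> = fact (Poly_Mapping.lookup ?b i) * (\<Prod>j\<in>?K - {i}. fact (Poly_Mapping.lookup ?b j))"
    by (rule prod.remove) auto
  also have "(\<Prod>j\<in>?K - {i}. fact (Poly_Mapping.lookup ?b j))
      = (\<Prod>j\<in>?K - {i}. fact (Poly_Mapping.lookup a j) :: nat)"
    by (rule prod.cong) (auto simp: lookup_add lookup_single when_def)
  also have "fact (Poly_Mapping.lookup ?b i)
      = (Poly_Mapping.lookup a i + 1) * fact (Poly_Mapping.lookup a i)"
    by (simp add: lookup_add)
  also have "\<dots> * (\<Prod>j\<in>?K - {i}. fact (Poly_Mapping.lookup a j))
      = (Poly_Mapping.lookup a i + 1) * (\<Prod>j\<in>?K. fact (Poly_Mapping.lookup a j))"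
    by (subst (2) prod.remove[of _ i]) (auto simp: algebra_simps)
  also have "(\<Prod>j\<in>?K. fact (Poly_Mapping.lookup a j)) = expo_fact a"
    by (rule expo_fact_superset[symmetric]) auto
  finally show ?thesis .
qed

text \<open>Weighting coefficients by a! absorbs the factor that each \<open>pd i\<close> produces,
  so the induction only shifts the exponent vector. The case a = 0 is Taylor's formula at the
  origin.\<close>

lemma mcoeff_foldr_pd:
  "of_nat (expo_fact a) * mcoeff (foldr pd is f) a
     = of_nat (expo_fact (a + list_expo is)) * mcoeff f (a + list_expo is)"
proof (induction "is" arbitrary: a)
  case (Cons i "is")
  have "of_nat (expo_fact a) * mcoeff (foldr pd (i # is) f) a
      = of_nat (expo_fact (a + Poly_Mapping.single (i - 1) 1))
          * mcoeff (foldr pd is f) (a + Poly_Mapping.single (i - 1) 1)"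
    unfolding expo_fact_add_single by (simp add: mcoeff_pd algebra_simps)
  then show ?case unfolding Cons.IH by (simp add: list_expo_Cons add.assoc)
qed simp

lemma mcoeff_foldr_pd_0:
  "mcoeff (foldr pd is f) 0 = of_nat (expo_fact (list_expo is)) * mcoeff f (list_expo is)"
  using mcoeff_foldr_pd[of 0 "is" f] by simp

lemma expo_fact_list_expo:
  assumes "\<forall>i\<in>set is. 1 \<le> i"
  shows "expo_fact (list_expo is) = (\<Prod>i\<in>set is. fact (count (mset is) i))"
proof -
  have "expo_fact (list_expo is) = (\<Prod>j\<in>(\<lambda>i. i - 1) ` set is. fact (count (mset is) (Suc j)))"
    using assms by (subst expo_fact_superset[of "(\<lambda>i. i - 1) ` set is"])
      (force simp: in_keys_iff lookup_list_expo[OF assms] image_iff not_in_iff intro!: prod.cong)+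
  also have "\<dots> = (\<Prod>i\<in>set is. fact (count (mset is) (Suc (i - 1))))"
    using assms by (subst prod.reindex) (auto intro!: inj_onI, metis le_add_diff_inverse)
  also have "\<dots> = (\<Prod>i\<in>set is. fact (count (mset is) i))"
    using assms by (intro prod.cong) auto
  finally show ?thesis .
qed

text \<open>The lists giving a fixed monomial are the permutations of one multiset, k!/a! in number.
  This reconciles the factor 1/k! in \<open>witten_part\<close> with Taylor's 1/a!.\<close>

lemma card_lists_with_expo:
  assumes "\<forall>i\<in>set is. 1 \<le> i"
  shows "card {js. (\<forall>j\<in>set js. 1 \<le> j) \<and> list_expo js = list_expo is} * expo_fact (list_expo is)
    = fact (length is)"
proof -
  have "{js. (\<forall>j\<in>set js. 1 \<le> j) \<and> list_expo js = list_expo is}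
      = permutations_of_multiset (mset is)"
    using assms list_expo_eq_iff[OF _ assms]
    by (auto simp: permutations_of_multiset_def) (metis mset_eq_setD)+
  then show ?thesis
    using card_permutations_of_multiset_aux[of "mset is"] assms
    by (simp add: expo_fact_list_expo mult.commute)
qed


section \<open>The Witten solution\<close>

text \<open>Each term of the infinite sum has a factor x_{i+n} with i \<ge> 1, which the monomial a
  lacks; only the quadratic part remains.\<close>

lemma mcoeff_pd_1_witten:
  assumes "witten_string n W" and "\<forall>i>n. Poly_Mapping.lookup a (i - 1) = 0"
  shows "mcoeff (pd 1 W) a = 1 / 2 *
    (\<Sum>(i, j) | 1 \<le> i \<and> 1 \<le> j \<and> i + j = n. of_nat (i * j) * (if a = list_expo [i, j] then 1 else 0))"
proof -
  have "mcoeff (of_nat (i + n) * xvar (i + n) * pd i W) a = 0" if "1 \<le> i" for i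
    using that assms(2) by (simp add: mult.assoc mcoeff_xvar_mult_eq_0 del: of_nat_add)
  then have "mcoeff (mps_sum {1..} (\<lambda>i. of_nat (i + n) * xvar (i + n) * pd i W)) a = 0"
    by (simp add: mps_sum_def)
  moreover have "mcoeff (xvar i * xvar j :: complex mps) a
      = (if a = list_expo [i, j] then 1 else 0)" for i j :: nat
    using mcoeff_prod_list_xvar[of "[i, j]" a] by simp
  ultimately show ?thesis
    using assms(1) unfolding witten_string_def
    by (simp add: mcoeff_sum split_def del: of_nat_mult)
qed

lemma jet_witten_0:
  assumes "witten_string n W" and s: "1 \<le> s" "s < n" and t: "1 \<le> t"
  shows "mcoeff (jet W (s, t)) 0 = (if (s, t) = (n - 1, 2) then of_nat (n - 1) else 0)"
proof -
  \<comment> \<open>One of the t derivatives in direction x_1 turns W into the left side of the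
    string equation; \<open>is'\<close> lists the others, all with index at most n.\<close>
  define is' where "is' = s # replicate (t - 1) 1"
  let ?P = "{(i, j). 1 \<le> i \<and> 1 \<le> j \<and> i + j = n}"
  let ?Q = "{(i, j). 1 \<le> i \<and> 1 \<le> j \<and> i + j = n \<and> mset is' = {#i, j#}}"
  have pos: "\<forall>i\<in>set is'. 1 \<le> i" using s by (auto simp: is'_def)
  have "(pd 1 ^^ t) W = foldr pd (replicate (t - 1) 1) (pd 1 W)"
    using t by (cases t) (simp_all add: funpow_swap1)
  then have "jet W (s, t) = foldr pd is' (pd 1 W)"
    by (simp add: jet_def is'_def)
  moreover have "\<forall>i>n. Poly_Mapping.lookup (list_expo is') (i - 1) = 0"
    using s unfolding lookup_list_expo[OF pos] by (auto simp: is'_def)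
  ultimately have *: "mcoeff (jet W (s, t)) 0 = of_nat (expo_fact (list_expo is')) * (1 / 2 *
      (\<Sum>(i, j)\<in>?P. of_nat (i * j) * (if list_expo is' = list_expo [i, j] then 1 else 0)))"
    using mcoeff_pd_1_witten[OF assms(1)] by (simp add: mcoeff_foldr_pd_0)
  have "finite ?P" by (rule finite_subset[of _ "{..n} \<times> {..n}"]) auto
  then have "(\<Sum>(i, j)\<in>?P. of_nat (i * j) * (if list_expo is' = list_expo [i, j] then 1 else 0))
      = (\<Sum>(i, j)\<in>?Q. of_nat (i * j) :: complex)"
    by (intro sum.mono_neutral_cong_right) (auto simp: list_expo_eq_iff[OF pos] split: if_splits)
  with * have jet: "mcoeff (jet W (s, t)) 0
      = of_nat (expo_fact (list_expo is')) * (1 / 2 * (\<Sum>(i, j)\<in>?Q. of_nat (i * j)))"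
    by simp
  show ?thesis
  proof (cases "(s, t) = (n - 1, 2)")
    case False
    have "mset is' \<noteq> {#i, j#}" if "i + j = n" for i j
    proof
      assume eq: "mset is' = {#i, j#}"
      then have "size (mset is') = 2" by simp
      then have "t = 2" using t by (simp add: is'_def)
      then have "{#s, 1#} = {#i, j#}" using eq by (simp add: is'_def)
      then have "s + 1 = i + j" by (auto simp: add_eq_conv_ex)
      with that False \<open>t = 2\<close> show False by auto
    qed
    then have Q: "?Q = {}" by auto
    have "mcoeff (jet W (s, t)) 0 = 0" unfolding jet Q by simp
    with False show ?thesis by (simp only: if_False)
  next
    case True
    have is': "is' = [n - 1, 1]" using True by (simp add: is'_def)
    have Q: "?Q = {(n - 1, 1), (1, n - 1)}"
      using s True by (auto simp: is' add_eq_conv_ex)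
    \<comment> \<open>For n > 2 the two ordered pairs cancel the factor 1/2. For n = 2 they
      coincide, and the factorial of x_1^2 supplies the missing 2.\<close>
    have "mcoeff (jet W (s, t)) 0 = of_nat (n - 1)"
    proof (cases "n - 1 = 1")
      case True
      then show ?thesis unfolding jet Q expo_fact_list_expo[OF pos] unfolding is' by simp
    next
      case False
      then show ?thesis unfolding jet Q expo_fact_list_expo[OF pos] unfolding is' by auto
    qed
    with True show ?thesis by (simp only: if_True simp_thms)
  qed
qed

section \<open>The hierarchy at the origin\<close>

text \<open>Every column has positive weight s + t, so the total weight bounds both the number of
  columns and the entries t.\<close>

lemma finite_gd_matrices: "finite (gd_matrices n is)"
proof -
  have "gd_matrices n is
      \<subseteq> {cs. set cs \<subseteq> {..n} \<times> {..sum_list is} \<and> length cs \<le> sum_list is}"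
  proof
    fix cs assume cs: "cs \<in> gd_matrices n is"
    then have sum: "sum_list is = (\<Sum>(s, t)\<leftarrow>cs. s + t)"
      and pos: "\<forall>(s, t)\<in>set cs. 1 \<le> s \<and> s < n \<and> 1 \<le> t"
      by (auto simp: gd_matrices_def)
    have "t \<le> sum_list is" if "(s, t) \<in> set cs" for s t
      using member_le_sum_list[of "s + t" "map (\<lambda>(s, t). s + t) cs"] that sum by force
    moreover have "length cs \<le> (\<Sum>(s, t)\<leftarrow>cs. s + t)" using pos
      by (induction cs) auto
    ultimately show "cs \<in> {cs. set cs \<subseteq> {..n} \<times> {..sum_list is} \<and> length cs \<le> sum_list is}"
      using pos sum by fastforce
  qed
  moreover have "finite {cs. set cs \<subseteq> {..n} \<times> {..sum_list is} \<and> length cs \<le> sum_list is}"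
    by (rule finite_lists_length_le) auto
  ultimately show ?thesis by (rule finite_subset)
qed

text \<open>Here the entries t add up to 2m, so with k = \<open>length is\<close> the inequality and
  the parity condition say that m = 2g - 2 + k for some g \<ge> 0.\<close>

lemma replicate_in_gd_matrices_iff:
  "replicate m (n - 1, 2) \<in> gd_matrices n is
     \<longleftrightarrow> m \<ge> 1 \<and> 2 \<le> n \<and> sum_list is = (n + 1) * m \<and> length is \<le> m + 2 \<and> even (length is + m)"
  by (auto simp: gd_matrices_def sum_list_replicate algebra_simps)

lemma mcoeff_foldr_pd_witten_0:
  assumes n: "n \<ge> 2" and W: "witten_solution \<epsilon> n W" and "is": "\<forall>i\<in>set is. 1 \<le> i \<and> i < n"
  shows "mcoeff (foldr pd is W) 0 =
    (if length is \<ge> 2 \<and> sum_list is = (n + 1) * (length is - 2)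
     then of_nat (n - 1) ^ (length is - 2)
       * of_rat (gd_N \<epsilon> n is (replicate (length is - 2) (n - 1, 2)))
     else 0)"
proof (cases "length is \<ge> 2")
  case False
  \<comment> \<open>The system says nothing for fewer than two derivatives; the normalisation of W
    at 0 settles these cases.\<close>
  then consider "is = []" | i where "is = [i]"
    by (cases "is" rule: list.exhaust; cases "tl is") auto
  then show ?thesis
    using W "is" by cases (simp_all add: witten_solution_def)
next
  case True
  let ?k = "length is" and ?c = "(n - 1, 2 :: nat)"
  let ?term = "\<lambda>cs. of_rat (gd_N \<epsilon> n is cs) * (\<Prod>z\<leftarrow>cs. mcoeff (jet W z) 0)"
  let ?M = "{cs \<in> gd_matrices n is. set cs \<subseteq> {?c}}"
  have jet: "mcoeff (jet W z) 0 = (if z = ?c then of_nat (n - 1) else 0)"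
    if "cs \<in> gd_matrices n is" "z \<in> set cs" for cs z
    using that W jet_witten_0[of n W "fst z" "snd z"]
    by (cases z) (auto simp: gd_matrices_def witten_solution_def)
  have "foldr pd is W = (\<Sum>cs\<in>gd_matrices n is.
      mconst (of_rat (gd_N \<epsilon> n is cs)) * (\<Prod>z\<leftarrow>cs. jet W z))"
    using W True "is" by (auto simp: witten_solution_def gd_system_def)
  then have "mcoeff (foldr pd is W) 0 = (\<Sum>cs\<in>gd_matrices n is. ?term cs)"
    by (simp add: mcoeff_sum mcoeff_prod_list_0)
  also have "\<dots> = (\<Sum>cs\<in>?M. ?term cs)"
  \<comment> \<open>A single column other than (n-1, 2) contributes a vanishing factor.\<close>
  proof (rule sum.mono_neutral_right[OF finite_gd_matrices], blast, rule ballI)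
    fix cs assume cs: "cs \<in> gd_matrices n is - ?M"
    then obtain z where z: "z \<in> set cs" "z \<noteq> ?c" by auto
    with cs have "mcoeff (jet W z) 0 = 0" using jet[of cs z] by simp
    with z(1) have "\<exists>z\<in>set cs. mcoeff (jet W z) 0 = 0" by blast
    then show "?term cs = 0" by (auto simp: prod_list_zero_iff image_iff)
  qed
  also have "\<dots> = (\<Sum>cs\<in>?M. of_nat (n - 1) ^ length cs * of_rat (gd_N \<epsilon> n is cs))"
  proof (rule sum.cong[OF refl])
    fix cs assume "cs \<in> ?M"
    moreover from this have "map (\<lambda>z. mcoeff (jet W z) 0) cs = map (\<lambda>z. of_nat (n - 1)) cs"
      using jet by (intro map_cong) auto
    ultimately show "?term cs = of_nat (n - 1) ^ length cs * of_rat (gd_N \<epsilon> n is cs)"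
      by (simp add: map_replicate_const)
  qed
  also have "?M = (if sum_list is = (n + 1) * (?k - 2) then {replicate (?k - 2) ?c} else {})"
  proof -
    have M: "?M = {replicate m ?c | m. replicate m ?c \<in> gd_matrices n is}"
    proof (intro equalityI subsetI)
      fix cs assume cs: "cs \<in> ?M"
      then have "cs = replicate (length cs) ?c"
        by (intro replicate_eqI) auto
      then show "cs \<in> {replicate m ?c | m. replicate m ?c \<in> gd_matrices n is}"
        using cs by (metis (mono_tags, lifting) mem_Collect_eq)
    qed auto
    have "sum_list is \<le> m * ?k" if "\<forall>i\<in>set is. i \<le> m" for m
      using that by (induction "is") auto
    moreover have "\<forall>i\<in>set is. i \<le> n - 1" using "is" by auto
    ultimately have le: "sum_list is \<le> (n - 1) * ?k" .
    have ge: "?k \<le> sum_list is"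
      using "is" by (induction "is") auto
    \<comment> \<open>By parity, m > k - 2 would give m \<ge> k, hence weight at least (n+1)k, while
      indices below n allow at most (n-1)k.\<close>
    have genus: "m = ?k - 2"
      if m: "sum_list is = (n + 1) * m" "?k \<le> m + 2" "even (?k + m)" for m
    proof (rule ccontr)
      assume "m \<noteq> ?k - 2"
      moreover from this m True have "m \<noteq> ?k - 1" by auto
      ultimately have "?k \<le> m" using m True by linarith
      then have "(n + 1) * ?k \<le> (n - 1) * ?k" using le m(1) by (metis le_trans mult_le_mono2)
      moreover have "(n - 1) * ?k < (n + 1) * ?k" using True by (intro mult_strict_right_mono) auto
      ultimately show False by simp
    qed
    have "replicate m ?c \<in> gd_matrices n is
        \<longleftrightarrow> m = ?k - 2 \<and> sum_list is = (n + 1) * (?k - 2)" for m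
    proof
      assume "replicate m ?c \<in> gd_matrices n is"
      then show "m = ?k - 2 \<and> sum_list is = (n + 1) * (?k - 2)"
        using genus[of m] unfolding replicate_in_gd_matrices_iff by blast
    next
      assume m: "m = ?k - 2 \<and> sum_list is = (n + 1) * (?k - 2)"
      \<comment> \<open>Matrices need at least one column; m = 0 would force weight 0, but k \<ge> 2
        positive indices have positive sum.\<close>
      then have "m \<noteq> 0" using ge True by auto
      then show "replicate m ?c \<in> gd_matrices n is"
        using m n True unfolding replicate_in_gd_matrices_iff by auto
    qed
    then show ?thesis unfolding M by auto
  qed
  finally show ?thesis using True by auto
qed

section \<open>Comparison of the coefficients of W and its genus 0 part\<close>

text \<open>Each ordered list giving the monomial a contributes a!/k! times the coefficient of W,
  and there are k!/a! such lists.\<close>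

lemma mcoeff_witten_part_0:
  assumes n: "n \<ge> 2" and W: "witten_solution \<epsilon> n W"
    and a: "\<forall>i\<ge>n. Poly_Mapping.lookup a (i - 1) = 0"
  shows "mcoeff (witten_part \<epsilon> n 0) a = mcoeff W a"
proof -
  obtain js where js: "\<forall>j\<in>set js. 1 \<le> j" and a_js: "a = list_expo js"
    by (rule list_expo_surj[of a]) auto
  define I where "I = {is. length is \<ge> 2 \<and> (\<forall>i\<in>set is. 1 \<le> i)
    \<and> sum_list is = (n + 1) * (length is - 2)}"
  define A where "A = {is. (\<forall>i\<in>set is. 1 \<le> i) \<and> list_expo is = a}"
  define c where "c is = of_nat (n - 1) ^ (length is - 2) / fact (length is)
    * (of_rat (gd_N \<epsilon> n is (replicate (length is - 2) (n - 1, 2))) :: complex)" for "is"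
  have mset: "mset is = mset js" if "is \<in> A" for "is"
    using that js a_js list_expo_eq_iff[of "is" js] by (auto simp: A_def)
  have len: "length is = length js" if "is \<in> A" for "is"
    using mset[OF that] by (rule mset_eq_length)
  have less: "i < n" if "is \<in> A" "i \<in> set is" for i "is"
  proof (rule ccontr)
    assume "\<not> i < n"
    then have "count (mset is) (Suc (i - 1)) = 0"
      using a that lookup_list_expo[of "is" "i - 1"] by (auto simp: A_def)
    then show False using that by (auto simp: A_def count_mset_0_iff)
  qed
  have finA: "finite A"
    using mset by (intro finite_subset[OF _ finite_permutations_of_multiset[of "mset js"]])
      (auto simp: permutations_of_multiset_def)
  \<comment> \<open>Lists outside \<open>I\<close> also fit: there the derivative of W at 0
    vanishes, so the contribution is the same for every list in \<open>A\<close>.\<close>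
  have summand: "(if is \<in> I then c is else 0)
      = of_nat (expo_fact a) * mcoeff W a / fact (length js)" if "is \<in> A" for "is"
  proof -
    have "mcoeff (foldr pd is W) 0 = of_nat (expo_fact a) * mcoeff W a"
      using that by (simp add: mcoeff_foldr_pd_0 A_def)
    moreover have "mcoeff (foldr pd is W) 0
        = (if is \<in> I then c is * fact (length is) else 0)"
      using that less[OF that] mcoeff_foldr_pd_witten_0[OF n W, of "is"]
      by (auto simp: A_def I_def c_def)
    ultimately show ?thesis using len[OF that] by (auto simp: field_simps)
  qed
  have "mcoeff (witten_part \<epsilon> n 0) a
      = (\<Sum>is | is \<in> I \<and> c is * (if a = list_expo is then 1 else 0) \<noteq> 0.
           c is * (if a = list_expo is then 1 else 0))"
    by (simp add: witten_part_def mps_sum_def Let_def mcoeff_prod_list_xvar I_def c_def)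
  also have "\<dots> = (\<Sum>is\<in>A. if is \<in> I then c is else 0)"
    \<comment> \<open>\<open>mps_sum\<close> keeps only nonzero terms; passing to the finite set
      \<open>A\<close> adds zeros only.\<close>
    by (rule sum.mono_neutral_cong_left[OF finA]) (auto simp: A_def I_def split: if_splits)
  also have "\<dots> = (\<Sum>is\<in>A. of_nat (expo_fact a) * mcoeff W a / fact (length js))"
    using summand by (intro sum.cong refl)
  also have "\<dots> = of_nat (card A * expo_fact a) * mcoeff W a / fact (length js)"
    by (simp add: algebra_simps)
  also have "card A * expo_fact a = fact (length js)"
    using card_lists_with_expo[OF js] by (simp add: A_def a_js)
  finally show ?thesis by simp
qed

theorem theorem6p2:
  fixes n :: nat and \<epsilon> :: complex and W :: "complex mps"
  assumes "n \<ge> 2"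
    and "\<epsilon> = 1 \<or> \<epsilon> = - 1"
    and "witten_solution \<epsilon> n W"
  shows "restrict_L0 n W = restrict_L0 n (witten_part \<epsilon> n 0)"
  using mcoeff_witten_part_0[OF assms(1,3)] by (simp add: restrict_L0_def cong: if_cong)

end
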